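(* The following two assertions are equivalent: (a) for every $n\ge 1$, every finite set $\Sigma\subset\mathbb{Q}_{\ge 0}^{n\times n}$ of nonnegative rational matrices has the finiteness property; (b) for every $n\ge 1$, every pair $\{B_0,B_1\}\subset\{0,1\}^{n\times n}$ of binary matrices has the finiteness property.
   Context: For a finite nonempty set $\Sigma\subset\mathbb{R}^{n\times n}$ and $t\ge 1$, let $\Sigma^t=\{A_1\cdots A_t : A_i\in\Sigma\}$ be the set of products of length $t$ of matrices from $\Sigma$. The joint spectral radius of $\Sigma$ is $\rho(\Sigma)=\limsup_{t\to\infty}\max\{\|A\|^{1/t}: A\in\Sigma^t\}$, which does not depend on the chosen matrix norm $\|\cdot\|$. For a single matrix $A$, $\rho(A)$ denotes its usual spectral radius. $\Sigma$ has the finiteness property if there exist $t\ge 1$ and a product $A\in\Sigma^t$ such that $\rho(\Sigma)=\rho(A)^{1/t}$. A binary matrix is a matrix with entries in $\{0,1\}$. *)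

theory Defs
  imports "Jordan_Normal_Form.Spectral_Radius" "HOL-Library.Extended_Real"
begin

text \<open>The set of products \<open>A\<^sub>1 \<cdots> A\<^sub>t\<close> with all factors in \<open>\<Sigma>\<close>,
  a set of \<open>n \<times> n\<close> matrices.\<close>

definition mat_products :: "nat \<Rightarrow> real mat set \<Rightarrow> nat \<Rightarrow> real mat set" where
  "mat_products n S t = {foldr (*) As (1\<^sub>m n) | As. length As = t \<and> set As \<subseteq> S}"

text \<open>Maximum absolute row sum, the operator norm induced by the maximum norm on vectors
  (for matrices with at least one row). The joint spectral radius does not depend on the choice
  of the norm.\<close>

definition row_sum_norm :: "real mat \<Rightarrow> real" where
  "row_sum_norm A = Max ((\<lambda>i. \<Sum>j<dim_col A. \<bar>A $$ (i, j)\<bar>) ` {..<dim_row A})"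

text \<open>The limit superior is taken in the extended reals only because \<open>limsup\<close> needs a complete
  lattice; for a finite nonempty \<open>S\<close> and \<open>n \<ge> 1\<close> its value is a nonnegative real. The term at
  \<open>t = 0\<close> is irrelevant.\<close>

definition joint_spectral_radius :: "nat \<Rightarrow> real mat set \<Rightarrow> ereal" where
  "joint_spectral_radius n S =
     limsup (\<lambda>t. ereal (Max ((\<lambda>A. root t (row_sum_norm A)) ` mat_products n S t)))"

definition finiteness_property :: "nat \<Rightarrow> real mat set \<Rightarrow> bool" where
  "finiteness_property n S \<longleftrightarrow>
     (\<exists>t\<ge>1. \<exists>A\<in>mat_products n S t.
        joint_spectral_radius n S = ereal (root t (spectral_radius (map_mat complex_of_real A))))"

end

theory Submission
  imports Defs
begin

text \<open>Only the reduction of a finite set of nonnegative rational matrices to a binary pair needs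
  work. After multiplication by a common denominator \<open>d\<close>, the matrices \<open>A\<^sub>k\<close> (\<open>k < m\<close>) are the
  adjacency matrices of multigraphs whose edges are labelled by \<open>k\<close>. Subdivide every edge with
  label \<open>k\<close> into a path of length \<open>L = m + 1\<close> reading a binary code word of \<open>k\<close>, and let \<open>B\<^sub>0\<close>, \<open>B\<^sub>1\<close>
  be the adjacency matrices of the edges reading the two letters. The product of the \<open>B\<^sub>b\<close> along
  the encoding of a word \<open>u\<close> contains \<open>d\<^sup>|\<^sup>u\<^sup>|A\<^sub>u\<close> as a block, so that
  \<open>d \<rho>(\<Sigma>) \<le> \<rho>(B\<^sub>0, B\<^sub>1)\<^sup>L\<close>. Conversely, every nonzero eigenvalue of a product \<open>B\<^sub>v\<close> of length \<open>t\<close>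
  has its \<open>L\<close>-th power among the eigenvalues of some \<open>d\<^sup>tA\<^sub>u\<close> with \<open>|u| = t\<close>. Hence a
  product realising \<open>\<rho>(B\<^sub>0, B\<^sub>1)\<close> yields one realising \<open>\<rho>(\<Sigma>)\<close>.\<close>

subsection \<open>Products, norms and spectral radii\<close>

text \<open>Indexing products by words over \<open>I\<close> lets the encoding and decoding of words
  act on products.\<close>

lemma mat_products_image:
  "mat_products n (M ` I) t =
     {foldr (*) (map M u) (1\<^sub>m n) | u. length u = t \<and> set u \<subseteq> I}"
proof -
  have "set As \<subseteq> M ` I \<longleftrightarrow> (\<exists>u. As = map M u \<and> set u \<subseteq> I)" for As
    using lists_image[of M I] by (auto simp: in_lists_conv_set subset_iff lists_eq_set)
  then show ?thesis
    unfolding mat_products_def by auto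
qed

lemma foldr_mult_carrier:
  assumes "set As \<subseteq> carrier_mat n n"
  shows "foldr (*) As (1\<^sub>m n) \<in> carrier_mat n n"
  using assms by (induction As) auto

lemma foldr_mult_append:
  fixes As :: "'a::semiring_1 mat list"
  assumes "set As \<subseteq> carrier_mat n n" "set Bs \<subseteq> carrier_mat n n"
  shows "foldr (*) (As @ Bs) (1\<^sub>m n) = foldr (*) As (1\<^sub>m n) * foldr (*) Bs (1\<^sub>m n)"
  using assms(1)
proof (induction As)
  case Nil
  then show ?case using foldr_mult_carrier[OF assms(2)] by simp
next
  case (Cons A As)
  then show ?case
    using foldr_mult_carrier[OF assms(2)] foldr_mult_carrier[of As n]
    by (simp add: assoc_mult_mat[of A n n _ n _ n])
qed

lemma mat_products_carrier:
  assumes "S \<subseteq> carrier_mat n n" "A \<in> mat_products n S t"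
  shows "A \<in> carrier_mat n n"
  using assms foldr_mult_carrier unfolding mat_products_def by blast

lemma finite_mat_products:
  assumes "finite S"
  shows "finite (mat_products n S t)"
proof -
  have "mat_products n S t = (\<lambda>As. foldr (*) As (1\<^sub>m n)) ` {As. set As \<subseteq> S \<and> length As = t}"
    unfolding mat_products_def by auto
  then show ?thesis
    using finite_lists_length_eq[OF assms] by simp
qed

lemma mat_products_nonempty:
  assumes "S \<noteq> {}"
  shows "mat_products n S t \<noteq> {}"
proof -
  obtain A where "A \<in> S" using assms by blast
  then have "foldr (*) (replicate t A) (1\<^sub>m n) \<in> mat_products n S t"
    unfolding mat_products_def by (intro CollectI exI[of _ "replicate t A"]) auto
  then show ?thesis by blast
qed

lemma mat_products_mult:
  assumes "S \<subseteq> carrier_mat n n" "A \<in> mat_products n S s" "B \<in> mat_products n S t"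
  shows "A * B \<in> mat_products n S (s + t)"
proof -
  obtain As where As: "A = foldr (*) As (1\<^sub>m n)" "length As = s" "set As \<subseteq> S"
    using assms unfolding mat_products_def by auto
  obtain Bs where Bs: "B = foldr (*) Bs (1\<^sub>m n)" "length Bs = t" "set Bs \<subseteq> S"
    using assms unfolding mat_products_def by auto
  have "A * B = foldr (*) (As @ Bs) (1\<^sub>m n)"
    using As Bs assms(1) foldr_mult_append[of As n Bs] by auto
  with As Bs show ?thesis
    unfolding mat_products_def by (intro CollectI exI[of _ "As @ Bs"]) auto
qed

lemma mat_products_power:
  assumes "S \<subseteq> carrier_mat n n" "A \<in> mat_products n S t"
  shows "A ^\<^sub>m k \<in> mat_products n S (t * k)"
proof (induction k)
  case 0
  have "A \<in> carrier_mat n n" using mat_products_carrier assms by blast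
  then show ?case by (auto simp: mat_products_def)
next
  case (Suc k)
  then show ?case using mat_products_mult[OF assms(1) Suc assms(2)] by (simp add: add.commute)
qed

section \<open>Row sums as bounds for eigenvalues\<close>

lemma row_sum_norm_ge:
  assumes "i < dim_row A"
  shows "(\<Sum>j<dim_col A. \<bar>A $$ (i, j)\<bar>) \<le> row_sum_norm A"
  unfolding row_sum_norm_def using assms by (intro Max_ge) auto

lemma row_sum_norm_attained:
  assumes "dim_row A > 0"
  shows "\<exists>i<dim_row A. row_sum_norm A = (\<Sum>j<dim_col A. \<bar>A $$ (i, j)\<bar>)"
proof -
  have "row_sum_norm A \<in> (\<lambda>i. \<Sum>j<dim_col A. \<bar>A $$ (i, j)\<bar>) ` {..<dim_row A}"
    unfolding row_sum_norm_def using assms by (intro Max_in) auto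
  then show ?thesis by auto
qed

lemma row_sum_norm_nonneg:
  assumes "dim_row A > 0"
  shows "row_sum_norm A \<ge> 0"
  using row_sum_norm_attained[OF assms] by (auto intro: sum_nonneg)

lemma norm_eigenvalue_le_row_sum_norm:
  assumes A: "A \<in> carrier_mat n n" and ev: "eigenvalue (map_mat complex_of_real A) \<mu>"
  shows "cmod \<mu> \<le> row_sum_norm A"
proof -
  let ?A = "map_mat complex_of_real A"
  obtain v where v: "v \<in> carrier_vec n" "v \<noteq> 0\<^sub>v n" "?A *\<^sub>v v = \<mu> \<cdot>\<^sub>v v"
    using ev A by (auto simp: eigenvalue_def eigenvector_def)
  obtain i0 where i0: "i0 < n" "v $ i0 \<noteq> 0"
    using v by (metis carrier_vecD eq_vecI index_zero_vec)
  \<comment> \<open>The eigenvalue equation is estimated at a coordinate \<open>i\<close> where the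
    eigenvector has maximal modulus.\<close>
  have "Max ((\<lambda>i. cmod (v $ i)) ` {..<n}) \<in> (\<lambda>i. cmod (v $ i)) ` {..<n}"
    using i0 by (intro Max_in) auto
  then obtain i where i: "i < n" "cmod (v $ i) = Max ((\<lambda>i. cmod (v $ i)) ` {..<n})"
    by auto
  have le: "cmod (v $ j) \<le> cmod (v $ i)" if "j < n" for j
    unfolding i(2) using that by (intro Max_ge) auto
  have pos: "cmod (v $ i) > 0"
    using le[OF i0(1)] i0(2) by (meson norm_le_zero_iff not_le order_trans)
  have "\<mu> * v $ i = (?A *\<^sub>v v) $ i"
    using v i by simp
  also have "\<dots> = (\<Sum>j<n. complex_of_real (A $$ (i, j)) * v $ j)"
    using A v(1) i(1) by (auto simp: scalar_prod_def atLeast0LessThan intro!: sum.cong)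
  finally have "cmod \<mu> * cmod (v $ i) \<le> (\<Sum>j<n. cmod (complex_of_real (A $$ (i, j)) * v $ j))"
    by (metis norm_mult norm_sum)
  also have "\<dots> \<le> (\<Sum>j<n. \<bar>A $$ (i, j)\<bar> * cmod (v $ i))"
    by (intro sum_mono) (auto simp: norm_mult intro: mult_left_mono le)
  also have "\<dots> = (\<Sum>j<n. \<bar>A $$ (i, j)\<bar>) * cmod (v $ i)"
    by (simp add: sum_distrib_right)
  finally have "cmod \<mu> \<le> (\<Sum>j<n. \<bar>A $$ (i, j)\<bar>)"
    using pos by simp
  then show ?thesis
    using row_sum_norm_ge[of i A] i(1) A by auto
qed

lemma spectral_radius_attained:
  assumes "A \<in> carrier_mat n n" "n \<ge> 1"
  obtains \<mu> where "eigenvalue A \<mu>" "spectral_radius A = cmod \<mu>"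
  using spectral_radius_mem_max(1)[OF assms(1)] assms(2) unfolding spectrum_def by auto

lemma norm_eigenvalue_le_spectral_radius:
  assumes "A \<in> carrier_mat n n" "eigenvalue A \<mu>"
  shows "cmod \<mu> \<le> spectral_radius A"
  using spectral_radius_mem_max(2)[OF assms(1) eigenvalue_imp_nonzero_dim[OF assms]] assms(2)
  unfolding spectrum_def by auto

lemma spectral_radius_nonneg:
  assumes "A \<in> carrier_mat n n" "n \<ge> 1"
  shows "spectral_radius A \<ge> 0"
  by (rule spectral_radius_attained[OF assms]) simp

text \<open>An eigenvector of \<open>A\<close> for an eigenvalue of maximal modulus is also one of
  the \<open>k\<close>-th power, whose norm bounds the \<open>k\<close>-th power of the
  eigenvalue.\<close>

lemma spectral_radius_power_le_row_sum_norm: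
  assumes A: "A \<in> carrier_mat n n" and n: "n \<ge> 1"
  shows "spectral_radius (map_mat complex_of_real A) ^ k \<le> row_sum_norm (A ^\<^sub>m k)"
proof -
  let ?A = "map_mat complex_of_real A"
  have cA: "?A \<in> carrier_mat n n" using A by simp
  obtain \<mu> where \<mu>: "eigenvalue ?A \<mu>" "spectral_radius ?A = cmod \<mu>"
    using spectral_radius_attained[OF cA n] by blast
  then obtain v where v: "eigenvector ?A v \<mu>" by (auto simp: eigenvalue_def)
  have "eigenvector (?A ^\<^sub>m k) v (\<mu> ^ k)"
    using v eigenvector_pow[OF cA v] cA by (auto simp: eigenvector_def)
  then have "eigenvalue (map_mat complex_of_real (A ^\<^sub>m k)) (\<mu> ^ k)"
    unfolding eigenvalue_def of_real_hom.mat_hom_pow[OF A] by blast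
  then have "cmod (\<mu> ^ k) \<le> row_sum_norm (A ^\<^sub>m k)"
    using norm_eigenvalue_le_row_sum_norm[OF pow_carrier_mat[OF A]] by blast
  then show ?thesis using \<mu>(2) by (simp add: norm_power)
qed

section \<open>Bounds for the joint spectral radius and transfer of the finiteness property\<close>

lemma joint_spectral_radius_ge:
  assumes n: "n \<ge> 1" and S: "finite S" "S \<subseteq> carrier_mat n n"
    and t: "t \<ge> 1" and A: "A \<in> mat_products n S t"
  shows "ereal (root t (spectral_radius (map_mat complex_of_real A))) \<le> joint_spectral_radius n S"
proof (rule ccontr)
  let ?r = "spectral_radius (map_mat complex_of_real A)"
  assume "\<not> ?thesis"
  then have "joint_spectral_radius n S < ereal (root t ?r)" by simp
  then have "\<forall>\<^sub>F \<tau> in sequentially.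
      ereal (Max ((\<lambda>A. root \<tau> (row_sum_norm A)) ` mat_products n S \<tau>)) < ereal (root t ?r)"
    unfolding joint_spectral_radius_def by (rule Limsup_lessD)
  then obtain K where K: "\<And>\<tau>. \<tau> \<ge> K \<Longrightarrow>
      Max ((\<lambda>A. root \<tau> (row_sum_norm A)) ` mat_products n S \<tau>) < root t ?r"
    unfolding eventually_sequentially by auto
  \<comment> \<open>Powers of \<open>A\<close> are products of length \<open>t * k\<close> whose
    normalised norms never fall below \<open>root t ?r\<close>. The successor keeps \<open>k\<close>
    positive even if \<open>K\<close> is 0.\<close>
  define k where "k = Suc K"
  have k: "k \<ge> 1" "t * k \<ge> K" using t by (auto simp: k_def trans_le_add2)
  have cA: "A \<in> carrier_mat n n" using mat_products_carrier[OF S(2) A] .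
  have r0: "?r \<ge> 0" using spectral_radius_nonneg[of "map_mat complex_of_real A" n] cA n by simp
  have "root t ?r = root (t * k) (?r ^ k)"
    using k t r0 by (simp add: real_root_mult_exp real_root_power real_root_pos2)
  also have "\<dots> \<le> root (t * k) (row_sum_norm (A ^\<^sub>m k))"
    using spectral_radius_power_le_row_sum_norm[OF cA n] k t by simp
  also have "\<dots> \<le> Max ((\<lambda>A. root (t * k) (row_sum_norm A)) ` mat_products n S (t * k))"
    using finite_mat_products[OF S(1)] mat_products_power[OF S(2) A] by (intro Max_ge) auto
  also have "\<dots> < root t ?r" using K k by blast
  finally show False by simp
qed

text \<open>Taking \<open>t\<close>-th roots turns growth of at most \<open>R ^ t\<close> into the
  bound \<open>R\<close> on the terms of the limit superior; then \<open>R\<close> decreases to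
  \<open>r\<close>.\<close>

lemma joint_spectral_radius_le:
  assumes S: "finite S" "S \<noteq> {}" and r: "r \<ge> 0"
    and le: "\<And>R. R > r \<Longrightarrow> \<forall>\<^sub>F t in sequentially. \<forall>A\<in>mat_products n S t. row_sum_norm A \<le> R ^ t"
  shows "joint_spectral_radius n S \<le> ereal r"
proof (rule ereal_le_epsilon2)
  fix e :: real
  assume e: "0 < e"
  have less: "r < r + e" using e by simp
  have "\<forall>\<^sub>F t in sequentially.
      ereal (Max ((\<lambda>A. root t (row_sum_norm A)) ` mat_products n S t)) \<le> ereal (r + e)"
    using le[of "r + e", OF less] eventually_gt_at_top[of 0]
  proof eventually_elim
    case (elim t)
    have "root t (row_sum_norm A) \<le> r + e" if "A \<in> mat_products n S t" for A
    proof -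
      have "root t (row_sum_norm A) \<le> root t ((r + e) ^ t)" using elim that by simp
      also have "\<dots> = r + e" using elim e r by (simp add: real_root_power_cancel)
      finally show ?thesis .
    qed
    then show ?case
      using finite_mat_products[OF S(1)] mat_products_nonempty[OF S(2)] by simp
  qed
  then show "joint_spectral_radius n S \<le> ereal r + ereal e"
    unfolding joint_spectral_radius_def by (simp add: Limsup_bounded)
qed

text \<open>Assumption \<open>norm\<close> gives d \<rho>(S) \<le> \<rho>(T)^L. By
  \<open>radius\<close>, a product of length t attaining \<rho>(T) yields a product A of the same
  length over S with \<rho>(T)^L \<le> d \<rho>(A)^(1/t). Hence \<rho>(S) \<le> \<rho>(A)^(1/t), and
  the reverse inequality holds for every product.\<close>

lemma finiteness_property_transfer:
  assumes n: "n \<ge> 1" and S: "finite S" "S \<noteq> {}" "S \<subseteq> carrier_mat n n"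
    and N: "N \<ge> 1" and T: "finite T" "T \<subseteq> carrier_mat N N"
    and L: "L \<ge> 1" and d: "d > (0::real)"
    and norm: "\<And>t A. A \<in> mat_products n S t \<Longrightarrow>
        \<exists>B\<in>mat_products N T (t * L). d ^ t * row_sum_norm A \<le> row_sum_norm B"
    and radius: "\<And>t B. t \<ge> 1 \<Longrightarrow> B \<in> mat_products N T t \<Longrightarrow>
        \<exists>A\<in>mat_products n S t. spectral_radius (map_mat complex_of_real B) ^ L
          \<le> d ^ t * spectral_radius (map_mat complex_of_real A)"
    and fin: "finiteness_property N T"
  shows "finiteness_property n S"
proof -
  obtain t B where t: "t \<ge> 1" and B: "B \<in> mat_products N T t"
    and jsr: "joint_spectral_radius N T = ereal (root t (spectral_radius (map_mat complex_of_real B)))"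
    using fin unfolding finiteness_property_def by blast
  define b where "b = spectral_radius (map_mat complex_of_real B)"
  have b0: "b \<ge> 0"
    unfolding b_def using mat_products_carrier[OF T(2) B] N by (intro spectral_radius_nonneg[of _ N]) auto
  obtain A where A: "A \<in> mat_products n S t"
    and bA: "b ^ L \<le> d ^ t * spectral_radius (map_mat complex_of_real A)"
    using radius[OF t B] unfolding b_def by blast
  define a where "a = spectral_radius (map_mat complex_of_real A)"
  \<comment> \<open>Since \<open>root t b\<close> is the joint spectral radius of \<open>T\<close>,
    this is the upper bound for that of \<open>S\<close> that \<open>norm\<close> will give.\<close>
  define r where "r = root t b ^ L / d"
  have r0: "r \<ge> 0" unfolding r_def using b0 d real_root_ge_zero[OF b0] by simp
  have ra: "r \<le> root t a"
  proof -
    have "root t (b ^ L) \<le> root t (d ^ t * a)" using bA t a_def by simp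
    also have "\<dots> = d * root t a" using t d by (simp add: real_root_mult real_root_power_cancel)
    finally show ?thesis unfolding r_def using t d b0
      by (simp add: real_root_power field_simps)
  qed
  have "joint_spectral_radius n S \<le> ereal r"
  proof (rule joint_spectral_radius_le[OF S(1,2) r0])
    fix R :: real
    assume R: "R > r"
    \<comment> \<open>With \<open>q ^ L = R * d\<close>, the inequality \<open>R > r\<close> says
      that \<rho>(T) < q, and a bound \<open>q ^ (L * \<tau>)\<close> for products over
      \<open>T\<close> becomes \<open>R ^ \<tau> * d ^ \<tau>\<close>.\<close>
    define q where "q = root L (R * d)"
    have R0: "R > 0" using R r0 by simp
    have qL: "q ^ L = R * d" unfolding q_def using L R0 d by simp
    have q0: "q > 0" unfolding q_def using L R0 d by simp
    have "root t b ^ L < q ^ L" unfolding qL using R d by (simp add: r_def field_simps)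
    then have "root t b < q" using q0 by (meson less_le_not_le linorder_not_less power_less_imp_less_base)
    then have "joint_spectral_radius N T < ereal q" using jsr b_def by simp
    then have "\<forall>\<^sub>F \<tau> in sequentially.
      ereal (Max ((\<lambda>A. root \<tau> (row_sum_norm A)) ` mat_products N T \<tau>)) < ereal q"
      unfolding joint_spectral_radius_def by (rule Limsup_lessD)
    then obtain K where K: "\<And>\<tau>. \<tau> \<ge> K \<Longrightarrow>
        Max ((\<lambda>A. root \<tau> (row_sum_norm A)) ` mat_products N T \<tau>) < q"
      unfolding eventually_sequentially by auto
    \<comment> \<open>\<open>Suc K\<close> excludes length 0, where \<open>root\<close> is 0 by
      convention and cannot be undone by a power.\<close>
    have "row_sum_norm C \<le> R ^ \<tau>" if \<tau>: "\<tau> \<ge> Suc K" and C: "C \<in> mat_products n S \<tau>" for \<tau> C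
    proof -
      obtain D where D: "D \<in> mat_products N T (\<tau> * L)" "d ^ \<tau> * row_sum_norm C \<le> row_sum_norm D"
        using norm[OF C] by blast
      have \<tau>L: "\<tau> * L > 0" "\<tau> * L \<ge> K"
        using \<tau> L by (auto intro: order_trans[of K \<tau>])
      have D0: "row_sum_norm D \<ge> 0"
        using mat_products_carrier[OF T(2) D(1)] N by (intro row_sum_norm_nonneg) auto
      have "root (\<tau> * L) (row_sum_norm D) \<le> Max ((\<lambda>A. root (\<tau> * L) (row_sum_norm A)) ` mat_products N T (\<tau> * L))"
        using finite_mat_products[OF T(1)] D(1) by (intro Max_ge) auto
      also have "\<dots> < q" using K \<tau>L by blast
      finally have "root (\<tau> * L) (row_sum_norm D) ^ (\<tau> * L) \<le> q ^ (\<tau> * L)"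
        using D0 \<tau>L by (intro power_mono) auto
      then have "row_sum_norm D \<le> q ^ (L * \<tau>)"
        using \<tau>L D0 by (simp add: mult.commute)
      also have "\<dots> = R ^ \<tau> * d ^ \<tau>" by (simp add: power_mult qL power_mult_distrib)
      finally have "d ^ \<tau> * row_sum_norm C \<le> d ^ \<tau> * R ^ \<tau>" using D(2) by (simp add: mult.commute)
      then show ?thesis using d by simp
    qed
    then show "\<forall>\<^sub>F t in sequentially. \<forall>A\<in>mat_products n S t. row_sum_norm A \<le> R ^ t"
      unfolding eventually_sequentially by blast
  qed
  then have "joint_spectral_radius n S \<le> ereal (root t a)"
    using ra by (meson ereal_less_eq(3) order_trans)
  moreover have "ereal (root t a) \<le> joint_spectral_radius n S"
    unfolding a_def using joint_spectral_radius_ge[OF n S(1,3) t A] .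
  ultimately show ?thesis
    unfolding finiteness_property_def using t A a_def by (meson antisym)
qed

subsection \<open>Path weights as matrix products\<close>

text \<open>The product of the matrices \<open>k a\<close> along a word, indexed by states instead
  of numbers; it counts the paths through \<open>X\<close> that read the word.\<close>

fun path_weight :: "'s set \<Rightarrow> ('a \<Rightarrow> 's \<Rightarrow> 's \<Rightarrow> nat) \<Rightarrow> 'a list \<Rightarrow> 's \<Rightarrow> 's \<Rightarrow> nat" where
  "path_weight X k [] s r = of_bool (s = r)"
| "path_weight X k (a # w) s r = (\<Sum>q\<in>X. k a s q * path_weight X k w q r)"

lemma path_weight_append:
  assumes "finite X" "s \<in> X"
  shows "path_weight X k (u @ v) s r = (\<Sum>q\<in>X. path_weight X k u s q * path_weight X k v q r)"
  using assms(2)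
proof (induction u arbitrary: s)
  case Nil
  have "(\<Sum>q\<in>X. path_weight X k [] s q * path_weight X k v q r)
      = (\<Sum>q\<in>{s}. path_weight X k [] s q * path_weight X k v q r)"
    using assms(1) Nil by (intro sum.mono_neutral_right) auto
  then show ?case by simp
next
  case (Cons a u)
  have "path_weight X k ((a # u) @ v) s r =
      (\<Sum>q\<in>X. \<Sum>p\<in>X. k a s q * path_weight X k u q p * path_weight X k v p r)"
    using Cons.IH by (simp add: sum_distrib_left mult.assoc)
  also have "\<dots> = (\<Sum>p\<in>X. \<Sum>q\<in>X. k a s q * path_weight X k u q p * path_weight X k v p r)"
    by (rule sum.swap)
  also have "\<dots> = (\<Sum>p\<in>X. path_weight X k (a # u) s p * path_weight X k v p r)"
    by (simp add: sum_distrib_right)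
  finally show ?case .
qed

text \<open>The bijection \<open>f\<close> numbers the states. Each letter absorbs one factor
  \<open>c\<close>, which clears denominators: it is the common denominator for the rational
  matrices and 1 for the binary ones.\<close>

lemma foldr_mult_path_weight:
  fixes c :: real
  assumes f: "bij_betw f {..<N} X" and M: "M ` I \<subseteq> carrier_mat N N"
    and k: "\<And>a x y. a \<in> I \<Longrightarrow> x < N \<Longrightarrow> y < N \<Longrightarrow> c * M a $$ (x, y) = k a (f x) (f y)"
    and "set w \<subseteq> I" "x < N" "y < N"
  shows "c ^ length w * foldr (*) (map M w) (1\<^sub>m N) $$ (x, y) = path_weight X k w (f x) (f y)"
  using assms(4,5)
proof (induction w arbitrary: x)
  case Nil
  then show ?case
    using f \<open>y < N\<close> by (auto simp: bij_betw_def inj_on_def)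
next
  case (Cons a w)
  let ?W = "foldr (*) (map M w) (1\<^sub>m N)"
  have cM: "M a \<in> carrier_mat N N" using M Cons by auto
  have cW: "?W \<in> carrier_mat N N" using M Cons by (intro foldr_mult_carrier) auto
  have "(M a * ?W) $$ (x, y) = (\<Sum>z<N. M a $$ (x, z) * ?W $$ (z, y))"
    using cM cW Cons.prems \<open>y < N\<close> by (auto simp: scalar_prod_def atLeast0LessThan intro!: sum.cong)
  then have "c ^ length (a # w) * foldr (*) (map M (a # w)) (1\<^sub>m N) $$ (x, y)
      = (\<Sum>z<N. (c * M a $$ (x, z)) * (c ^ length w * ?W $$ (z, y)))"
    by (simp add: sum_distrib_left mult_ac)
  also have "\<dots> = (\<Sum>z<N. real (k a (f x) (f z) * path_weight X k w (f z) (f y)))"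
    using Cons k by (intro sum.cong) auto
  also have "\<dots> = (\<Sum>q\<in>X. real (k a (f x) q * path_weight X k w q (f y)))"
    by (rule sum.reindex_bij_betw[OF f])
  finally show ?case by simp
qed

section \<open>Eigenvalues of kernels on an arbitrary index set\<close>

definition kernel_eigenvalue :: "'s set \<Rightarrow> ('s \<Rightarrow> 's \<Rightarrow> nat) \<Rightarrow> complex \<Rightarrow> bool" where
  "kernel_eigenvalue X K \<mu> \<longleftrightarrow>
     (\<exists>\<xi>. (\<exists>s\<in>X. \<xi> s \<noteq> 0) \<and> (\<forall>s\<in>X. (\<Sum>r\<in>X. of_nat (K s r) * \<xi> r) = \<mu> * \<xi> s))"

lemma kernel_eigenvalue_cong:
  assumes "\<And>s r. s \<in> X \<Longrightarrow> r \<in> X \<Longrightarrow> K s r = K' s r"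
  shows "kernel_eigenvalue X K \<mu> \<longleftrightarrow> kernel_eigenvalue X K' \<mu>"
  unfolding kernel_eigenvalue_def using assms by simp

text \<open>Eigenvectors correspond to functions on \<open>X\<close> through the numbering
  \<open>f\<close>; scaling the matrix by \<open>c\<close> scales the eigenvalue.\<close>

lemma eigenvalue_iff_kernel_eigenvalue:
  fixes A :: "real mat"
  assumes f: "bij_betw f {..<N} X" and A: "A \<in> carrier_mat N N" and c: "c \<noteq> 0"
    and K: "\<And>x y. x < N \<Longrightarrow> y < N \<Longrightarrow> c * A $$ (x, y) = K (f x) (f y)"
  shows "eigenvalue (map_mat complex_of_real A) \<mu> \<longleftrightarrow> kernel_eigenvalue X K (of_real c * \<mu>)"
proof -
  let ?A = "map_mat complex_of_real A"
  have Av: "of_real c * (?A *\<^sub>v v) $ x = (\<Sum>y<N. of_nat (K (f x) (f y)) * v $ y)"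
    if v: "v \<in> carrier_vec N" and x: "x < N" for v x
  proof -
    have "(?A *\<^sub>v v) $ x = (\<Sum>y<N. complex_of_real (A $$ (x, y)) * v $ y)"
      using A v x by (auto simp: scalar_prod_def atLeast0LessThan intro!: sum.cong)
    then have "of_real c * (?A *\<^sub>v v) $ x = (\<Sum>y<N. complex_of_real (c * A $$ (x, y)) * v $ y)"
      by (simp add: sum_distrib_left mult.assoc)
    then show ?thesis using K x by simp
  qed
  have fX: "f x \<in> X" if "x < N" for x using that f by (auto simp: bij_betw_def)
  show ?thesis
  proof
    assume "eigenvalue ?A \<mu>"
    then obtain v where v: "v \<in> carrier_vec N" "v \<noteq> 0\<^sub>v N" "?A *\<^sub>v v = \<mu> \<cdot>\<^sub>v v"
      using A by (auto simp: eigenvalue_def eigenvector_def)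
    define \<xi> where "\<xi> s = v $ inv_into {..<N} f s" for s
    have \<xi>: "\<xi> (f x) = v $ x" if "x < N" for x
      using that f by (simp add: \<xi>_def bij_betw_def inv_into_f_f)
    obtain x where "x < N" "v $ x \<noteq> 0"
      using v by (metis carrier_vecD eq_vecI index_zero_vec)
    then have "\<exists>s\<in>X. \<xi> s \<noteq> 0" using \<xi> fX by metis
    moreover have "(\<Sum>r\<in>X. of_nat (K s r) * \<xi> r) = of_real c * \<mu> * \<xi> s" if "s \<in> X" for s
    proof -
      obtain x where x: "x < N" "s = f x" using f \<open>s \<in> X\<close> unfolding bij_betw_def by blast
      have "(\<Sum>r\<in>X. of_nat (K s r) * \<xi> r) = (\<Sum>y<N. of_nat (K s (f y)) * \<xi> (f y))"
        by (rule sum.reindex_bij_betw[OF f, symmetric])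
      also have "\<dots> = of_real c * (?A *\<^sub>v v) $ x" using x \<xi> Av[OF v(1)] by simp
      finally show ?thesis using v x \<xi> by simp
    qed
    ultimately show "kernel_eigenvalue X K (of_real c * \<mu>)"
      unfolding kernel_eigenvalue_def by blast
  next
    assume "kernel_eigenvalue X K (of_real c * \<mu>)"
    then obtain \<xi> s where s: "s \<in> X" "\<xi> s \<noteq> 0"
      and \<xi>: "\<And>s. s \<in> X \<Longrightarrow> (\<Sum>r\<in>X. of_nat (K s r) * \<xi> r) = of_real c * \<mu> * \<xi> s"
      unfolding kernel_eigenvalue_def by blast
    define v where "v = vec N (\<lambda>x. \<xi> (f x))"
    obtain x where x: "x < N" "s = f x" using f s unfolding bij_betw_def by blast
    have "v $ x \<noteq> 0" using s x by (simp add: v_def)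
    then have "v \<noteq> 0\<^sub>v N" using x by auto
    moreover have "?A *\<^sub>v v = \<mu> \<cdot>\<^sub>v v"
    proof (rule eq_vecI)
      fix y assume "y < dim_vec (\<mu> \<cdot>\<^sub>v v)"
      then have y: "y < N" by (simp add: v_def)
      have "of_real c * (?A *\<^sub>v v) $ y = (\<Sum>z<N. of_nat (K (f y) (f z)) * \<xi> (f z))"
        using Av[of v y] y by (simp add: v_def)
      also have "\<dots> = (\<Sum>r\<in>X. of_nat (K (f y) r) * \<xi> r)"
        by (rule sum.reindex_bij_betw[OF f])
      also have "\<dots> = of_real c * (\<mu> * v $ y)" using \<xi> fX y by (simp add: v_def)
      finally show "(?A *\<^sub>v v) $ y = (\<mu> \<cdot>\<^sub>v v) $ y" using c y by (simp add: v_def)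
    qed (use A in \<open>simp add: v_def\<close>)
    ultimately show "eigenvalue ?A \<mu>"
      using A unfolding eigenvalue_def eigenvector_def by (intro exI[of _ v]) (simp add: v_def)
  qed
qed

text \<open>Associativity: the kernel of \<open>u @ v\<close> acts on a vector as that of
  \<open>v\<close> followed by that of \<open>u\<close>.\<close>

lemma sum_path_weight_append:
  fixes \<xi> :: "'s \<Rightarrow> complex"
  assumes X: "finite X" "s \<in> X"
  shows "(\<Sum>r\<in>X. of_nat (path_weight X k (u @ v) s r) * \<xi> r)
    = (\<Sum>q\<in>X. of_nat (path_weight X k u s q) * (\<Sum>r\<in>X. of_nat (path_weight X k v q r) * \<xi> r))"
proof -
  have "(\<Sum>r\<in>X. of_nat (path_weight X k (u @ v) s r) * \<xi> r)
      = (\<Sum>r\<in>X. \<Sum>q\<in>X. of_nat (path_weight X k u s q) * of_nat (path_weight X k v q r) * \<xi> r)"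
    by (simp add: path_weight_append[OF X] sum_distrib_right)
  also have "\<dots> = (\<Sum>q\<in>X. of_nat (path_weight X k u s q) * (\<Sum>r\<in>X. of_nat (path_weight X k v q r) * \<xi> r))"
    by (subst sum.swap) (simp add: sum_distrib_left mult.assoc)
  finally show ?thesis .
qed

lemma sum_path_weight_replicate:
  fixes \<xi> :: "'s \<Rightarrow> complex"
  assumes X: "finite X"
    and \<xi>: "\<And>s. s \<in> X \<Longrightarrow> (\<Sum>r\<in>X. of_nat (path_weight X k v s r) * \<xi> r) = \<mu> * \<xi> s"
    and s: "s \<in> X"
  shows "(\<Sum>r\<in>X. of_nat (path_weight X k (concat (replicate l v)) s r) * \<xi> r) = \<mu> ^ l * \<xi> s"
  using s
proof (induction l arbitrary: s)
  case 0
  have "(\<Sum>r\<in>X. of_nat (path_weight X k [] s r) * \<xi> r)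
      = (\<Sum>r\<in>{s}. of_nat (path_weight X k [] s r) * \<xi> r)"
    using X 0 by (intro sum.mono_neutral_right) auto
  then show ?case by simp
next
  case (Suc l)
  let ?w = "concat (replicate l v)"
  have "(\<Sum>r\<in>X. of_nat (path_weight X k (concat (replicate (Suc l) v)) s r) * \<xi> r)
      = (\<Sum>q\<in>X. of_nat (path_weight X k v s q) * (\<Sum>r\<in>X. of_nat (path_weight X k ?w q r) * \<xi> r))"
    using sum_path_weight_append[OF X Suc.prems] by simp
  also have "\<dots> = (\<Sum>q\<in>X. of_nat (path_weight X k v s q) * (\<mu> ^ l * \<xi> q))"
    using Suc.IH by simp
  also have "\<dots> = \<mu> ^ l * (\<Sum>q\<in>X. of_nat (path_weight X k v s q) * \<xi> q)"
    by (simp add: sum_distrib_left mult_ac)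
  finally show ?case using \<xi> Suc.prems by simp
qed

subsection \<open>Subdivided multigraphs\<close>

text \<open>\<open>Mid k i j c p\<close> is the point reached after \<open>p\<close> letters on the \<open>c\<close>-th copy of the edge from
  \<open>i\<close> to \<open>j\<close> with label \<open>k\<close>.\<close>

datatype state = Base nat | Mid nat nat nat nat nat

text \<open>Position \<open>p\<close> on an edge with label \<open>k\<close> reads the letter
  \<open>p = k\<close>. Position 0 is the step out of a base vertex, position \<open>m\<close> the
  step back into one. The ranges of labels, copies and positions are imposed by
  \<open>states\<close>.\<close>

fun subdivision_step :: "nat \<Rightarrow> bool \<Rightarrow> state \<Rightarrow> state \<Rightarrow> bool" where
  "subdivision_step m b (Base i) (Mid k i' j c p) \<longleftrightarrow> i' = i \<and> p = 1 \<and> b = (0 = k)"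
| "subdivision_step m b (Mid k i j c p) (Mid k' i' j' c' p') \<longleftrightarrow>
     k' = k \<and> i' = i \<and> j' = j \<and> c' = c \<and> p' = Suc p \<and> b = (p = k)"
| "subdivision_step m b (Mid k i j c p) (Base j') \<longleftrightarrow> j' = j \<and> p = m \<and> b = (p = k)"
| "subdivision_step m b (Base i) (Base j) \<longleftrightarrow> False"

text \<open>Position along the current edge, to be taken modulo \<open>m + 1\<close>: every step
  within the states raises it by one, so the subdivided graph is periodic.\<close>

fun phase :: "state \<Rightarrow> nat" where
  "phase (Base i) = 0"
| "phase (Mid k i j c p) = p"

text \<open>\<open>cnt k i j\<close> is the number of parallel edges from \<open>i\<close> to
  \<open>j\<close> with label \<open>k\<close>. By \<open>m \<ge> 1\<close> each of them gets an
  inner vertex.\<close>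

locale edge_subdivision =
  fixes m n :: nat and cnt :: "nat \<Rightarrow> nat \<Rightarrow> nat \<Rightarrow> nat"
  assumes m: "m \<ge> 1"
begin

definition states :: "state set" where
  "states = Base ` {..<n} \<union>
     (\<lambda>(k, i, j, c, p). Mid k i j c p) `
       (SIGMA k:{..<m}. SIGMA i:{..<n}. SIGMA j:{..<n}. {..<cnt k i j} \<times> {1..m})"

text \<open>Indicator words of length \<open>m + 1\<close> rather than \<open>m\<close>: every subdivided edge needs an inner
  vertex, since otherwise parallel edges would merge when \<open>m = 1\<close>.\<close>

definition code :: "nat \<Rightarrow> bool list" where
  "code k = map (\<lambda>p. p = k) [0..<Suc m]"

abbreviation step :: "bool \<Rightarrow> state \<Rightarrow> state \<Rightarrow> nat" where
  "step b s r \<equiv> of_bool (subdivision_step m b s r)"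

abbreviation weight :: "bool list \<Rightarrow> state \<Rightarrow> state \<Rightarrow> nat" where
  "weight \<equiv> path_weight states step"

lemma finite_states: "finite states"
  unfolding states_def by (intro finite_UnI finite_imageI finite_SigmaI) auto

lemma Base_in_states [simp]: "Base i \<in> states \<longleftrightarrow> i < n"
  unfolding states_def by auto

lemma Mid_in_states [simp]:
  "Mid k i j c p \<in> states \<longleftrightarrow> k < m \<and> i < n \<and> j < n \<and> c < cnt k i j \<and> 1 \<le> p \<and> p \<le> m"
  unfolding states_def by (auto simp: image_iff)

lemma phase_le: "s \<in> states \<Longrightarrow> phase s \<le> m"
  by (cases s) auto

lemma phase_eq_0: "s \<in> states \<Longrightarrow> phase s = 0 \<longleftrightarrow> (\<exists>i<n. s = Base i)"
  by (cases s) auto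

lemma phase_step:
  "subdivision_step m b s r \<Longrightarrow> r \<in> states \<Longrightarrow> phase r = Suc (phase s) mod Suc m"
  using m by (cases "(m, b, s, r)" rule: subdivision_step.cases) auto

text \<open>Iterates \<open>phase_step\<close>. It serves to discard the inner vertices in sums over
  states whenever the word length fits.\<close>

lemma phase_weight:
  assumes "weight w s r \<noteq> 0" "s \<in> states"
  shows "phase r = (phase s + length w) mod Suc m"
  using assms
proof (induction w arbitrary: s)
  case Nil
  then show ?case using phase_le[of s] by (auto split: if_splits)
next
  case (Cons b w)
  then obtain q where "q \<in> states" "subdivision_step m b s q" "weight w q r \<noteq> 0"
    by (auto simp: finite_states split: if_splits)
  then show ?case
    using Cons.IH[of q] phase_step[of b s q] by (simp add: mod_simps)
qed

lemma sum_Base: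
  assumes "\<And>s. s \<in> states \<Longrightarrow> phase s \<noteq> 0 \<Longrightarrow> f s = 0"
  shows "sum f states = (\<Sum>i<n. f (Base i))"
proof -
  have "sum f states = sum f (Base ` {..<n})"
    using assms phase_eq_0 finite_states by (intro sum.mono_neutral_right) auto
  then show ?thesis
    by (simp add: sum.reindex inj_on_def)
qed

text \<open>Inside an edge the way forward is unique, so only the rest of its code word leads to a
  base vertex, namely to the head of the edge.\<close>

lemma weight_Mid_Base:
  assumes "Mid k i j c p \<in> states" "length w = Suc m - p"
  shows "weight w (Mid k i j c p) (Base l) = of_bool (l = j \<and> w = map (\<lambda>q. q = k) [p..<Suc m])"
  using assms
proof (induction w arbitrary: p)
  case Nil
  then show ?case by simp
next
  case (Cons b w)
  \<comment> \<open>The only successor within the states; at \<open>p = m\<close> the edge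
    ends.\<close>
  define r where "r = (if p = m then Base j else Mid k i j c (Suc p))"
  have r: "r \<in> states" using Cons.prems by (auto simp: r_def)
  have "subdivision_step m b (Mid k i j c p) q \<longleftrightarrow> b = (p = k) \<and> q = r"
    if "q \<in> states" for q
    using that Cons.prems by (cases q) (auto simp: r_def)
  then have "weight (b # w) (Mid k i j c p) (Base l)
      = (\<Sum>q\<in>states. if q = r then of_bool (b = (p = k)) * weight w q (Base l) else 0)"
    by (auto intro!: sum.cong)
  also have "\<dots> = of_bool (b = (p = k)) * weight w r (Base l)"
    using r finite_states by simp
  also have "weight w r (Base l) = of_bool (l = j \<and> w = map (\<lambda>q. q = k) [Suc p..<Suc m])"
    using Cons by (auto simp: r_def)
  also have "of_bool (b = (p = k)) * of_bool (l = j \<and> w = map (\<lambda>q. q = k) [Suc p..<Suc m])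
      = (of_bool (l = j \<and> b # w = map (\<lambda>q. q = k) [p..<Suc m]) :: nat)"
    using Cons.prems by (auto simp: upt_conv_Cons simp del: upt_Suc)
  finally show ?case .
qed

text \<open>A path of \<open>Suc m\<close> letters between base vertices traverses exactly one
  subdivided edge. Its first step picks label and copy and the rest is forced, so
  \<open>code k\<close> has one path per copy.\<close>

lemma weight_Base_Base:
  assumes w: "length w = Suc m" and ij: "i < n" "j < n"
  shows "weight w (Base i) (Base j) = (\<Sum>k<m. if w = code k then cnt k i j else 0)"
proof -
  obtain b v where bv: "w = b # v" "length v = m" using w by (cases w) auto
  let ?E = "SIGMA k:{..<m}. {..<cnt k i j}"
  let ?h = "\<lambda>(k, c). Mid k i j c 1"
  have "weight w (Base i) (Base j) = (\<Sum>q\<in>states. step b (Base i) q * weight v q (Base j))"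
    by (simp add: bv)
  also have "\<dots> = (\<Sum>q\<in>?h ` ?E. step b (Base i) q * weight v q (Base j))"
  proof (rule sum.mono_neutral_right[OF finite_states])
    show "?h ` ?E \<subseteq> states" using ij m by auto
    show "\<forall>q\<in>states - ?h ` ?E. step b (Base i) q * weight v q (Base j) = 0"
    proof
      fix q assume q: "q \<in> states - ?h ` ?E"
      show "step b (Base i) q * weight v q (Base j) = 0"
      proof (cases q)
        case (Mid k i' j' c p)
        \<comment> \<open>A wrong \<open>i'\<close> or \<open>p\<close> makes the first step
          impossible; a wrong \<open>j'\<close> leads to another base vertex than
          \<open>j\<close>.\<close>
        have "i' \<noteq> i \<or> p \<noteq> 1 \<or> j' \<noteq> j" using q Mid by (auto simp: image_iff)
        then show ?thesis
          using weight_Mid_Base[of k i' j' c p v j] q Mid bv(2) by auto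
      qed simp
    qed
  qed
  also have "\<dots> = (\<Sum>(k, c)\<in>?E. step b (Base i) (Mid k i j c 1) * weight v (Mid k i j c 1) (Base j))"
    by (subst sum.reindex) (auto simp: inj_on_def case_prod_unfold)
  also have "\<dots> = (\<Sum>(k, c)\<in>?E. of_bool (w = code k))"
  proof (rule sum.cong[OF refl], safe)
    fix k c assume "k < m" "c < cnt k i j"
    then have "weight v (Mid k i j c 1) (Base j) = of_bool (v = map (\<lambda>q. q = k) [1..<Suc m])"
      using weight_Mid_Base[of k i j c 1 v j] ij m bv(2) by simp
    moreover have "code k = (0 = k) # map (\<lambda>q. q = k) [1..<Suc m]"
      unfolding code_def by (simp add: upt_conv_Cons del: upt_Suc)
    ultimately show "step b (Base i) (Mid k i j c 1) * weight v (Mid k i j c 1) (Base j)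
        = of_bool (w = code k)"
      using bv by auto
  qed
  also have "\<dots> = (\<Sum>k<m. \<Sum>c<cnt k i j. of_bool (w = code k))"
    by (rule sum.Sigma[symmetric]) auto
  also have "\<dots> = (\<Sum>k<m. if w = code k then cnt k i j else 0)"
    by (intro sum.cong) auto
  finally show ?thesis .
qed

section \<open>Encoding and decoding of words\<close>

lemma length_code [simp]: "length (code k) = Suc m"
  by (simp add: code_def)

lemma code_inject:
  assumes "k < m" "code k = code l"
  shows "k = l"
proof -
  have "code k ! k = code l ! k" using assms(2) by simp
  then show ?thesis using assms(1) by (simp add: code_def del: upt_Suc)
qed

lemma weight_code:
  assumes "k < m" "i < n" "j < n"
  shows "weight (code k) (Base i) (Base j) = cnt k i j"
proof -
  have "weight (code k) (Base i) (Base j) = (\<Sum>l<m. if l = k then cnt l i j else 0)"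
    unfolding weight_Base_Base[OF length_code assms(2,3)]
    using code_inject[OF assms(1)] by (intro sum.cong) auto
  then show ?thesis using assms(1) by simp
qed

lemma weight_not_code:
  assumes "w \<notin> code ` {..<m}" "length w = Suc m" "i < n" "j < n"
  shows "weight w (Base i) (Base j) = 0"
  using weight_Base_Base[of w i j] assms by (auto intro!: sum.neutral)

text \<open>By \<open>phase_weight\<close>, a word whose length is a multiple of the period leads
  from base vertices only to base vertices.\<close>

lemma weight_append_Base:
  assumes "Suc m dvd length u" "i < n"
  shows "weight (u @ v) (Base i) r = (\<Sum>l<n. weight u (Base i) (Base l) * weight v (Base l) r)"
proof -
  have "weight u (Base i) s = 0" if "s \<in> states" "phase s \<noteq> 0" for s
    using phase_weight[of u "Base i" s] assms that by auto
  then show ?thesis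
    using path_weight_append[OF finite_states, of "Base i" step u v r] assms(2)
    by (simp add: sum_Base)
qed

abbreviation encode :: "nat list \<Rightarrow> bool list" where
  "encode u \<equiv> concat (map code u)"

lemma length_encode: "length (encode u) = length u * Suc m"
  by (induction u) auto

text \<open>Code words act on the base vertices as the kernels \<open>cnt k\<close>, so
  concatenating them multiplies these kernels.\<close>

lemma weight_encode:
  assumes "set u \<subseteq> {..<m}" "i < n" "j < n"
  shows "weight (encode u) (Base i) (Base j) = path_weight {..<n} cnt u i j"
  using assms
proof (induction u arbitrary: i)
  case (Cons k u)
  then have "weight (encode (k # u)) (Base i) (Base j) =
      (\<Sum>l<n. weight (code k) (Base i) (Base l) * weight (encode u) (Base l) (Base j))"
    using weight_append_Base[of "code k" i "encode u"] by simp
  with Cons show ?case by (simp add: weight_code)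
qed simp

text \<open>Cut \<open>w\<close> into blocks of length \<open>Suc m\<close>. A block that is no code
  word vanishes between base vertices, and then so does the whole word.\<close>

lemma weight_decode:
  assumes "length w = t * Suc m"
  shows "(\<exists>u. length u = t \<and> set u \<subseteq> {..<m} \<and> w = encode u) \<or>
    (\<forall>i<n. \<forall>j<n. weight w (Base i) (Base j) = 0)"
  using assms
proof (induction t arbitrary: w)
  case (Suc t)
  define a where "a = take (Suc m) w"
  define v where "v = drop (Suc m) w"
  have w: "w = a @ v" "length a = Suc m" "length v = t * Suc m"
    using Suc.prems by (auto simp: a_def v_def)
  have app: "weight w (Base i) (Base j) = (\<Sum>l<n. weight a (Base i) (Base l) * weight v (Base l) (Base j))"
    if "i < n" for i j
    using weight_append_Base[of a i v] w that by simp
  show ?case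
  proof (cases "a \<in> code ` {..<m}")
    case False
    then show ?thesis using app weight_not_code w(2) by simp
  next
    case True
    then obtain k where k: "k < m" "a = code k" by auto
    from Suc.IH[OF w(3)] show ?thesis
    proof
      assume "\<exists>u. length u = t \<and> set u \<subseteq> {..<m} \<and> v = encode u"
      then obtain u where "length u = t" "set u \<subseteq> {..<m}" "v = encode u" by blast
      then show ?thesis using k w by (intro disjI1 exI[of _ "k # u"]) auto
    next
      assume "\<forall>i<n. \<forall>j<n. weight v (Base i) (Base j) = 0"
      then show ?thesis using app by simp
    qed
  qed
qed simp

text \<open>The eigenvector of \<open>v\<close> may live on a phase \<open>p \<noteq> 0\<close>. Splitting \<open>v\<^sup>m\<^sup>+\<^sup>1 = x y\<close> with \<open>|y| = p\<close>,
  the word \<open>y\<close> carries it to an eigenvector of the rotated word \<open>y x\<close> that does not vanish on the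
  base vertices; \<open>y x\<close> must then be a concatenation of code words, as its eigenvalue is not 0.\<close>

lemma kernel_eigenvalue_decode:
  assumes t: "length v = t" "t \<ge> 1" and \<mu>: "\<mu> \<noteq> 0" and ev: "kernel_eigenvalue states (weight v) \<mu>"
  shows "\<exists>u. length u = t \<and> set u \<subseteq> {..<m} \<and>
    kernel_eigenvalue {..<n} (path_weight {..<n} cnt u) (\<mu> ^ Suc m)"
proof -
  let ?\<nu> = "\<mu> ^ Suc m"
  obtain \<xi> s where s: "s \<in> states" "\<xi> s \<noteq> 0"
    and \<xi>: "\<And>s. s \<in> states \<Longrightarrow> (\<Sum>r\<in>states. of_nat (weight v s r) * \<xi> r) = \<mu> * \<xi> s"
    using ev unfolding kernel_eigenvalue_def by blast
  \<comment> \<open>Repeating \<open>v\<close> makes the length a multiple of the period whatever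
    \<open>t\<close> is, and raises the eigenvalue to \<open>?\<nu>\<close>.\<close>
  define z where "z = concat (replicate (Suc m) v)"
  have z\<xi>: "(\<Sum>r\<in>states. of_nat (weight z s r) * \<xi> r) = ?\<nu> * \<xi> s" if "s \<in> states" for s
    unfolding z_def by (rule sum_path_weight_replicate[OF finite_states \<xi> that])
  have lz: "length z = t * Suc m"
    using t by (simp add: z_def length_concat sum_list_replicate)
  \<comment> \<open>The phase of a state where \<open>\<xi>\<close> does not vanish. Reading
    \<open>x\<close> from there takes \<open>t * Suc m - p\<close> letters and so ends on base
    vertices.\<close>
  define p where "p = phase s"
  have p: "p \<le> m" "p \<le> t * Suc m"
    using phase_le[OF s(1)] mult_le_mono1[OF t(2), of "Suc m"] unfolding p_def by auto
  define x where "x = take (t * Suc m - p) z"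
  define y where "y = drop (t * Suc m - p) z"
  have xy: "z = x @ y" "length x = t * Suc m - p" "length y = p"
    using lz p by (auto simp: x_def y_def)
  define \<eta> where "\<eta> q = (\<Sum>r\<in>states. of_nat (weight y q r) * \<xi> r)" for q
  have "(\<Sum>q\<in>states. of_nat (weight x s q) * \<eta> q) = ?\<nu> * \<xi> s"
    using z\<xi>[OF s(1)] sum_path_weight_append[OF finite_states s(1), of step x y \<xi>]
    unfolding \<eta>_def xy(1) by simp
  moreover have "(\<Sum>q\<in>states. of_nat (weight x s q) * \<eta> q)
      = (\<Sum>l<n. of_nat (weight x s (Base l)) * \<eta> (Base l))"
  proof (rule sum_Base)
    fix q assume "q \<in> states" "phase q \<noteq> 0"
    moreover have "(phase s + length x) mod Suc m = 0"
      using xy(2) p by (simp add: p_def del: mult_Suc_right)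
    ultimately have "weight x s q = 0"
      using phase_weight[OF _ s(1), of x q] by auto
    then show "of_nat (weight x s q) * \<eta> q = 0" by simp
  qed
  \<comment> \<open>The kernel of \<open>x\<close> maps \<open>\<eta>\<close> to a vector that is
    nonzero at \<open>s\<close> and depends there only on base values, so \<open>\<eta>\<close>
    cannot vanish on all base vertices.\<close>
  ultimately have "(\<Sum>l<n. of_nat (weight x s (Base l)) * \<eta> (Base l)) \<noteq> 0"
    using \<mu> s(2) by simp
  then obtain l where l: "l < n" "\<eta> (Base l) \<noteq> 0"
    by (metis (no_types, lifting) lessThan_iff mult_zero_right sum.neutral)
  have lyx: "length (y @ x) = t * Suc m" using xy p by simp
  \<comment> \<open>Applying y x to \<eta> = y \<xi> gives y x y \<xi> = y z \<xi> = \<nu> y \<xi> =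
    \<nu> \<eta>, words standing for their kernels; by phases only base vertices contribute.\<close>
  have base: "(\<Sum>j<n. of_nat (weight (y @ x) (Base i) (Base j)) * \<eta> (Base j)) = ?\<nu> * \<eta> (Base i)"
    if "i < n" for i
  proof -
    have "(\<Sum>j<n. of_nat (weight (y @ x) (Base i) (Base j)) * \<eta> (Base j))
        = (\<Sum>q\<in>states. of_nat (weight (y @ x) (Base i) q) * \<eta> q)"
    proof (rule sum_Base[symmetric])
      fix q assume "q \<in> states" "phase q \<noteq> 0"
      then have "weight (y @ x) (Base i) q = 0"
        using phase_weight[of "y @ x" "Base i" q] that
        unfolding lyx by (auto simp del: mult_Suc_right)
      then show "of_nat (weight (y @ x) (Base i) q) * \<eta> q = 0" by simp
    qed
    also have "\<dots> = (\<Sum>r\<in>states. of_nat (weight (y @ z) (Base i) r) * \<xi> r)"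
      using sum_path_weight_append[OF finite_states, of "Base i" step "y @ x" y \<xi>] that
      unfolding \<eta>_def xy(1) by simp
    also have "\<dots> = (\<Sum>q\<in>states. of_nat (weight y (Base i) q) * (?\<nu> * \<xi> q))"
      using sum_path_weight_append[OF finite_states, of "Base i" step y z \<xi>] that z\<xi> by simp
    also have "\<dots> = ?\<nu> * \<eta> (Base i)"
      unfolding \<eta>_def by (simp add: sum_distrib_left mult_ac)
    finally show ?thesis .
  qed
  have "\<not> (\<forall>i<n. \<forall>j<n. weight (y @ x) (Base i) (Base j) = 0)"
  proof
    assume "\<forall>i<n. \<forall>j<n. weight (y @ x) (Base i) (Base j) = 0"
    then have "(\<Sum>j<n. of_nat (weight (y @ x) (Base l) (Base j)) * \<eta> (Base j)) = 0"
      using l(1) by (intro sum.neutral) auto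
    then show False
      using base[OF l(1)] l(2) \<mu> by simp
  qed
  then obtain u where u: "length u = t" "set u \<subseteq> {..<m}" "y @ x = encode u"
    using weight_decode[OF lyx] by blast
  have "kernel_eigenvalue {..<n} (\<lambda>i j. weight (y @ x) (Base i) (Base j)) ?\<nu>"
    unfolding kernel_eigenvalue_def using base l
    by (intro exI[of _ "\<lambda>i. \<eta> (Base i)"]) auto
  then have "kernel_eigenvalue {..<n} (path_weight {..<n} cnt u) ?\<nu>"
    using kernel_eigenvalue_cong[of "{..<n}" "\<lambda>i j. weight (y @ x) (Base i) (Base j)"]
      weight_encode[OF u(2)] u(3) by (metis (no_types, lifting) lessThan_iff)
  with u show ?thesis by blast
qed

end

subsection \<open>Reduction to binary pairs\<close>

text \<open>Denominators are multiplied one at a time; nonnegativity makes the numerators natural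
  numbers.\<close>

lemma common_denominator:
  assumes "finite X" "X \<subseteq> {x \<in> \<rat>. 0 \<le> x}"
  shows "\<exists>d::nat. d > 0 \<and> (\<forall>x\<in>X. \<exists>c::nat. real d * x = real c)"
  using assms
proof (induction X)
  case empty
  then show ?case by (intro exI[of _ 1]) simp
next
  case (insert x X)
  then obtain d :: nat where d: "d > 0" "\<forall>x\<in>X. \<exists>c::nat. real d * x = real c" by auto
  obtain a b :: nat where ab: "b \<noteq> 0" "\<bar>x\<bar> = real a / real b"
    using insert.prems Rats_abs_nat_div_natE[of x] by blast
  have "real (d * b) * x = real (d * a)"
    using ab insert.prems by (simp add: field_simps)
  moreover have "\<exists>c::nat. real (d * b) * y = real c" if y: "y \<in> X" for y
  proof -
    obtain c :: nat where "real d * y = real c" using d y by blast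
    then have "real (d * b) * y = real (b * c)" by (simp add: mult_ac)
    then show ?thesis by blast
  qed
  ultimately show ?case
    using d(1) ab(1) by (intro exI[of _ "d * b"]) (auto simp del: of_nat_mult)
qed

lemma finite_elements_mat: "finite (elements_mat A)"
proof -
  have "elements_mat A = (\<lambda>(i, j). A $$ (i, j)) ` ({..<dim_row A} \<times> {..<dim_col A})"
    unfolding elements_mat_def by auto
  then show ?thesis by simp
qed

text \<open>Serves to number the base vertices first, so that their block occupies the leading
  \<open>n\<close> rows and columns.\<close>

lemma bij_betw_extend_image:
  assumes X: "finite X" and g: "inj_on g {..<n}" "g ` {..<n} \<subseteq> X"
  obtains f where "bij_betw f {..<card X} X" "\<And>i. i < n \<Longrightarrow> f i = g i" "n \<le> card X"
proof -
  have c: "card (g ` {..<n}) = n" using g(1) by (simp add: card_image)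
  then have n: "n \<le> card X" using card_mono[OF X g(2)] by simp
  have "card {n..<card X} = card (X - g ` {..<n})"
    using card_Diff_subset[OF _ g(2)] c by simp
  then obtain h where h: "bij_betw h {n..<card X} (X - g ` {..<n})"
    using finite_same_card_bij[of "{n..<card X}" "X - g ` {..<n}"] X by auto
  define f where "f i = (if i \<in> {..<n} then g i else h i)" for i
  have "bij_betw f ({..<n} \<union> {n..<card X}) (g ` {..<n} \<union> (X - g ` {..<n}))"
    unfolding f_def using g(1) h by (intro bij_betw_disjoint_Un) (auto simp: inj_on_imp_bij_betw)
  moreover have "{..<n} \<union> {n..<card X} = {..<card X}" using n by auto
  moreover have "g ` {..<n} \<union> (X - g ` {..<n}) = X" using g(2) by auto
  ultimately have "bij_betw f {..<card X} X" by simp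
  moreover have "f i = g i" if "i < n" for i using that by (simp add: f_def)
  ultimately show thesis using that n by blast
qed

text \<open>The transfer applies with \<open>L = Suc m\<close>: the base block provides the norm
  estimate, \<open>kernel_eigenvalue_decode\<close> the spectral one.\<close>

lemma finiteness_property_if_binary:
  fixes S :: "real mat set"
  assumes n: "n \<ge> 1" and S: "finite S" "S \<noteq> {}" "S \<subseteq> carrier_mat n n"
    and nonneg: "\<And>A. A \<in> S \<Longrightarrow> elements_mat A \<subseteq> {x \<in> \<rat>. 0 \<le> x}"
    and binary: "\<And>N B0 B1. N \<ge> 1 \<Longrightarrow> B0 \<in> carrier_mat N N \<Longrightarrow> B1 \<in> carrier_mat N N \<Longrightarrow>
        elements_mat B0 \<subseteq> {0, 1} \<Longrightarrow> elements_mat B1 \<subseteq> {0, 1} \<Longrightarrow> finiteness_property N {B0, B1}"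
  shows "finiteness_property n S"
proof -
  have "\<Union> (elements_mat ` S) \<subseteq> {x \<in> \<rat>. 0 \<le> x}" using nonneg by blast
  then obtain d :: nat where d: "d > 0"
      "\<forall>x\<in>\<Union> (elements_mat ` S). \<exists>c::nat. real d * x = real c"
    using common_denominator[of "\<Union> (elements_mat ` S)"] S(1) finite_elements_mat by auto
  define m where "m = card S"
  have m: "m \<ge> 1" using S by (simp add: m_def card_gt_0_iff Suc_le_eq)
  obtain M where M: "bij_betw M {..<m} S"
    using ex_bij_betw_nat_finite[OF S(1)] by (auto simp: m_def atLeast0LessThan)
  then have MS: "M ` {..<m} = S" by (simp add: bij_betw_def)
  have cM: "M k \<in> carrier_mat n n" if "k < m" for k using that MS S(3) by blast
  have "\<exists>c::nat. real d * M k $$ (i, j) = real c" if "k < m" "i < n" "j < n" for k i j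
  proof -
    have "M k $$ (i, j) \<in> elements_mat (M k)"
      using elements_matI[OF cM[OF that(1)] that(2,3)] by simp
    then show ?thesis using d(2) MS that(1) by blast
  qed
  \<comment> \<open>The entries of the integer matrices \<open>d\<close> times \<open>M k\<close>
    become edge multiplicities.\<close>
  then obtain cnt where cnt: "\<And>k i j. k < m \<Longrightarrow> i < n \<Longrightarrow> j < n \<Longrightarrow> real d * M k $$ (i, j) = real (cnt k i j)"
    by metis
  interpret edge_subdivision m n cnt by standard (rule m)
  define N where "N = card states"
  obtain f where f: "bij_betw f {..<N} states" "\<And>i. i < n \<Longrightarrow> f i = Base i" "n \<le> N"
    unfolding N_def by (rule bij_betw_extend_image[OF finite_states, of Base n]) (auto simp: inj_on_def)
  have N: "N \<ge> 1" using f(3) n by simp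
  define B where "B b = mat N N (\<lambda>(x, y). real (step b (f x) (f y)))" for b
  have cB: "B b \<in> carrier_mat N N" for b by (simp add: B_def)
  have B_entry: "B b $$ (x, y) = step b (f x) (f y)" if "x < N" "y < N" for b x y
    using that by (simp add: B_def)
  have elB: "elements_mat (B b) \<subseteq> {0, 1}" for b
    unfolding elements_mat_def B_def by auto
  define T where "T = B ` UNIV"
  have T: "T = {B False, B True}" by (auto simp: T_def UNIV_bool)
  have cT: "T \<subseteq> carrier_mat N N" using cB by (auto simp: T_def)
  have fin: "finiteness_property N T"
    unfolding T using binary[OF N cB cB elB elB] .
  have S_entries: "real d ^ length u * foldr (*) (map M u) (1\<^sub>m n) $$ (i, j) = path_weight {..<n} cnt u i j"
    if "set u \<subseteq> {..<m}" "i < n" "j < n" for u i j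
    using foldr_mult_path_weight[of id n "{..<n}" M "{..<m}" "real d" cnt u i j] that cM cnt
    by auto
  have T_entries: "foldr (*) (map B w) (1\<^sub>m N) $$ (x, y) = weight w (f x) (f y)"
    if "x < N" "y < N" for w x y
    using foldr_mult_path_weight[of f N states B UNIV 1 step w x y] that f(1) cT B_entry
    by (simp add: T_def)
  have S_carrier: "foldr (*) (map M u) (1\<^sub>m n) \<in> carrier_mat n n" if "set u \<subseteq> {..<m}" for u
    using that cM by (intro foldr_mult_carrier) auto
  have T_carrier: "foldr (*) (map B w) (1\<^sub>m N) \<in> carrier_mat N N" for w
    using cB by (intro foldr_mult_carrier) auto
  have S_products: "mat_products n S t = {foldr (*) (map M u) (1\<^sub>m n) | u. length u = t \<and> set u \<subseteq> {..<m}}" for t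
    using mat_products_image[of n M "{..<m}" t] MS by simp
  have T_products: "mat_products N T t = {foldr (*) (map B w) (1\<^sub>m N) | w. length w = t}" for t
    using mat_products_image[of N B UNIV t] by (simp add: T_def)
  show ?thesis
  proof (rule finiteness_property_transfer[OF n S N _ cT, of "Suc m" "real d"])
    fix t A assume "A \<in> mat_products n S t"
    then obtain u where u: "length u = t" "set u \<subseteq> {..<m}" and A: "A = foldr (*) (map M u) (1\<^sub>m n)"
      unfolding S_products by blast
    define W where "W = foldr (*) (map B (encode u)) (1\<^sub>m N)"
    have cA: "A \<in> carrier_mat n n" and cW: "W \<in> carrier_mat N N"
      using S_carrier[OF u(2)] T_carrier by (auto simp: A W_def)
    \<comment> \<open>A row of maximal sum in \<open>A\<close> is, up to scaling, part of row
      \<open>i\<close> of \<open>W\<close>, whose further entries can only increase the sum.\<close>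
    obtain i where i: "i < n" "row_sum_norm A = (\<Sum>j<n. \<bar>A $$ (i, j)\<bar>)"
      using row_sum_norm_attained[of A] cA n by auto
    have entry: "real d ^ t * \<bar>A $$ (i, j)\<bar> = \<bar>W $$ (i, j)\<bar>" if j: "j < n" for j
    proof -
      have "real d ^ t * A $$ (i, j) = W $$ (i, j)"
        using S_entries[OF u(2) i(1) j] T_entries[of i j "encode u"] weight_encode[OF u(2) i(1) j]
          f(2,3) i(1) j u(1) by (simp add: A W_def)
      then have "\<bar>real d ^ t * A $$ (i, j)\<bar> = \<bar>W $$ (i, j)\<bar>" by simp
      then show ?thesis by (simp add: abs_mult)
    qed
    have "real d ^ t * row_sum_norm A = (\<Sum>j<n. \<bar>W $$ (i, j)\<bar>)"
      using entry by (simp add: i(2) sum_distrib_left)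
    also have "\<dots> \<le> (\<Sum>j<N. \<bar>W $$ (i, j)\<bar>)"
      using f(3) by (intro sum_mono2) auto
    also have "\<dots> \<le> row_sum_norm W"
      using row_sum_norm_ge[of i W] cW i(1) f(3) by auto
    finally have "real d ^ t * row_sum_norm A \<le> row_sum_norm W" .
    moreover have "W \<in> mat_products N T (t * Suc m)"
      unfolding T_products W_def using length_encode[of u] u(1) by blast
    ultimately show "\<exists>W\<in>mat_products N T (t * Suc m). real d ^ t * row_sum_norm A \<le> row_sum_norm W"
      by blast
  next
    fix t W assume t: "t \<ge> 1" and "W \<in> mat_products N T t"
    then obtain v where v: "length v = t" and W: "W = foldr (*) (map B v) (1\<^sub>m N)"
      unfolding T_products by blast
    let ?W = "map_mat complex_of_real W"
    have cW: "W \<in> carrier_mat N N" using T_carrier by (simp add: W)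
    then obtain \<mu> where \<mu>: "eigenvalue ?W \<mu>" "spectral_radius ?W = cmod \<mu>"
      using spectral_radius_attained[of ?W N] N by auto
    show "\<exists>A\<in>mat_products n S t. spectral_radius ?W ^ Suc m
        \<le> real d ^ t * spectral_radius (map_mat complex_of_real A)"
    proof (cases "\<mu> = 0")
      \<comment> \<open>Any product of length \<open>t\<close> serves, as the left-hand side is
        0.\<close>
      case True
      obtain A where A: "A \<in> mat_products n S t" using mat_products_nonempty[OF S(2)] by blast
      have "spectral_radius (map_mat complex_of_real A) \<ge> 0"
        using mat_products_carrier[OF S(3) A] n by (intro spectral_radius_nonneg[of _ n]) auto
      with True \<mu>(2) A show ?thesis by (intro bexI[of _ A]) auto
    next
      case False
      have "kernel_eigenvalue states (weight v) (of_real 1 * \<mu>)"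
        using eigenvalue_iff_kernel_eigenvalue[OF f(1) cW, of 1 "weight v" \<mu>] T_entries \<mu>(1)
        by (auto simp: W)
      then obtain u where u: "length u = t" "set u \<subseteq> {..<m}"
        and ev: "kernel_eigenvalue {..<n} (path_weight {..<n} cnt u) (\<mu> ^ Suc m)"
        using kernel_eigenvalue_decode[OF v t False] by auto
      define A where "A = foldr (*) (map M u) (1\<^sub>m n)"
      let ?A = "map_mat complex_of_real A"
      \<comment> \<open>The kernel of \<open>u\<close> is \<open>A\<close> scaled by
        \<open>real d ^ t\<close>; the division undoes this scaling on the eigenvalue.\<close>
      define \<nu> where "\<nu> = \<mu> ^ Suc m / of_real (real d ^ t)"
      have cA: "A \<in> carrier_mat n n" using S_carrier[OF u(2)] by (simp add: A_def)
      have \<nu>: "of_real (real d ^ t) * \<nu> = \<mu> ^ Suc m" using d(1) by (simp add: \<nu>_def)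
      have "eigenvalue ?A \<nu>"
        using eigenvalue_iff_kernel_eigenvalue[of id n "{..<n}" A "real d ^ t" "path_weight {..<n} cnt u" \<nu>]
          cA d(1) S_entries[OF u(2)] u(1) ev \<nu> by (auto simp: A_def simp del: power_Suc of_real_power)
      then have "cmod \<nu> \<le> spectral_radius ?A"
        using norm_eigenvalue_le_spectral_radius[of ?A n] cA by auto
      then have "real d ^ t * cmod \<nu> \<le> real d ^ t * spectral_radius ?A"
        by (intro mult_left_mono) auto
      moreover have "real d ^ t * cmod \<nu> = cmod \<mu> ^ Suc m"
        using arg_cong[OF \<nu>, of cmod] by (simp add: norm_mult norm_power)
      ultimately have "spectral_radius ?W ^ Suc m \<le> real d ^ t * spectral_radius ?A"
        using \<mu>(2) by simp
      moreover have "A \<in> mat_products n S t"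
        unfolding S_products A_def using u by blast
      ultimately show ?thesis by blast
    qed
  qed (use fin d(1) T in auto)
qed

theorem theorem1:
  shows "(\<forall>n\<ge>1. \<forall>S :: real mat set.
            finite S \<and> S \<noteq> {} \<and> S \<subseteq> carrier_mat n n \<and>
            (\<forall>A\<in>S. elements_mat A \<subseteq> {x \<in> \<rat>. 0 \<le> x}) \<longrightarrow>
            finiteness_property n S)
     \<longleftrightarrow>
         (\<forall>n\<ge>1. \<forall>B0\<in>carrier_mat n n. \<forall>B1\<in>carrier_mat n n.
            elements_mat B0 \<subseteq> {0, 1} \<and> elements_mat B1 \<subseteq> {0, 1} \<longrightarrow>
            finiteness_property n {B0, B1})"
    (is "?rational \<longleftrightarrow> ?binary")
proof
  assume rational: ?rational
  \<comment> \<open>A binary pair is an instance of the rational statement, since 0 and 1 are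
    nonnegative rationals.\<close>
  have sub: "{0, 1} \<subseteq> {x \<in> \<rat>. 0 \<le> (x::real)}" by auto
  show ?binary
  proof (intro allI ballI impI)
    fix n :: nat and B0 B1 :: "real mat"
    assume "n \<ge> 1" "B0 \<in> carrier_mat n n" "B1 \<in> carrier_mat n n"
      "elements_mat B0 \<subseteq> {0, 1} \<and> elements_mat B1 \<subseteq> {0, 1}"
    then show "finiteness_property n {B0, B1}"
      using rational[rule_format, of n "{B0, B1}"] sub by blast
  qed
next
  assume binary: ?binary
  show ?rational
  proof (intro allI impI, elim conjE)
    fix n :: nat and S :: "real mat set"
    assume "n \<ge> 1" "finite S" "S \<noteq> {}" "S \<subseteq> carrier_mat n n"
      "\<forall>A\<in>S. elements_mat A \<subseteq> {x \<in> \<rat>. 0 \<le> x}"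
    moreover have "finiteness_property N {B0, B1}"
      if "N \<ge> 1" "B0 \<in> carrier_mat N N" "B1 \<in> carrier_mat N N"
        "elements_mat B0 \<subseteq> {0, 1}" "elements_mat B1 \<subseteq> {0, 1}" for N B0 B1
      using binary that by blast
    ultimately show "finiteness_property n S"
      using finiteness_property_if_binary[of n S] by blast
  qed
qed

end
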